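(* Let $k,r$ be natural numbers. For each $j=1,\ldots,k$ let $l_j\in\{0,1,\ldots,j-1\}$ and $I_j=\{0,l_j,l_j+1\}$, and let $I=\prod_{j=1}^k I_j$. Let $c:\mathrm{FIN}_k\to\{1,2,\ldots,r\}$ be a colouring. Then there exists an infinite block sequence $B$ in $\mathrm{FIN}_k$ such that $\langle B\rangle_I$ is $c$-monochromatic.
   Context: $\mathbb{N}=\{1,2,3,\ldots\}$. For $k\in\mathbb{N}$, $\mathrm{FIN}_k$ is the set of functions $p:\mathbb{N}\to\{0,1,\ldots,k\}$ with finite support $\mathrm{supp}(p)=\{x:p(x)\ne0\}$ that attain the value $k$. An infinite sequence $(b_s)_{s\in\mathbb{N}}$ in $\mathrm{FIN}_k$ is a block sequence if $\max\mathrm{supp}(b_s)<\min\mathrm{supp}(b_{s+1})$ for all $s$. For an integer $i\ge1$, $T_i$ acts on finitely supported $p:\mathbb{N}\to\{0,1,2,\ldots\}$ by $T_i(p)(x)=p(x)$ if $p(x)<i$ and $p(x)-1$ if $p(x)\ge i$; $T_0$ is the identity. For $\vec t=(t(1),\ldots,t(k))$ with $t(j)\in\{0,\ldots,j\}$, $T_{\vec t}=T_{t(1)}\circ\cdots\circ T_{t(k)}$; $\vec0$ is the all-zero vector. For a block sequence $B=(b_s)$ and a set $I$ of such vectors containing $\vec0$, $\langle B\rangle_I$ is the set of all sums $T_{\vec t_1}(b_{s_1})+\cdots+T_{\vec t_q}(b_{s_q})$ with $q\ge1$, $s_1<\cdots<s_q$, $\vec t_1,\ldots,\vec t_q\in I$,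 and $\vec t_j=\vec0$ for some $j$. $c$-monochromatic means $c$ is constant on the set. *)

theory Defs
  imports "HOL-Analysis.Analysis"
begin

text \<open>
  In this theory the natural numbers of the mathematical text start at 1.  A function defined
  on them is represented by a function on \<^typ>\<open>nat\<close>; an element of \<open>FIN k\<close> is extended
  by the value 0 at the argument 0, so that functions with the same values at all positive
  arguments are equal.
\<close>

definition supp :: "(nat \<Rightarrow> nat) \<Rightarrow> nat set" where
  "supp p = {x. p x \<noteq> 0}"

definition FIN :: "nat \<Rightarrow> (nat \<Rightarrow> nat) set" where
  "FIN k = {p. p 0 = 0 \<and> (\<forall>x. p x \<le> k) \<and> finite (supp p) \<and> (\<exists>x. p x = k)}"

text \<open>Sequences are indexed from 1; their value at index 0 is irrelevant.\<close>

definition block_sequence :: "nat \<Rightarrow> (nat \<Rightarrow> nat \<Rightarrow> nat) \<Rightarrow> bool" where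
  "block_sequence k b \<longleftrightarrow>
     (\<forall>s\<ge>1. b s \<in> FIN k) \<and> (\<forall>s\<ge>1. Max (supp (b s)) < Min (supp (b (s + 1))))"

definition T :: "nat \<Rightarrow> (nat \<Rightarrow> nat) \<Rightarrow> nat \<Rightarrow> nat" where
  "T i p = (if i = 0 then p else (\<lambda>x. if p x < i then p x else p x - 1))"

text \<open>
  A vector \<open>(t(1), \<dots>, t(k))\<close> is an element of \<open>\<Pi>\<^sub>E j\<in>{1..k}. {0..j}\<close>; \<open>T_vec k t\<close> is the
  composition of \<open>T (t 1)\<close>, \dots, \<open>T (t k)\<close>, with \<open>T (t k)\<close> applied first.
\<close>

primrec T_vec :: "nat \<Rightarrow> (nat \<Rightarrow> nat) \<Rightarrow> (nat \<Rightarrow> nat) \<Rightarrow> nat \<Rightarrow> nat" where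
  "T_vec 0 t = id"
| "T_vec (Suc k) t = T_vec k t \<circ> T (t (Suc k))"

definition zero_vec :: "nat \<Rightarrow> nat \<Rightarrow> nat" where
  "zero_vec k = (\<lambda>j\<in>{1..k}. 0)"

definition block_span ::
    "nat \<Rightarrow> (nat \<Rightarrow> nat) set \<Rightarrow> (nat \<Rightarrow> nat \<Rightarrow> nat) \<Rightarrow> (nat \<Rightarrow> nat) set" where
  "block_span k I b =
     {(\<lambda>x. \<Sum>j=1..q. T_vec k (t j) (b (s j)) x) | (q :: nat) s t.
        q \<ge> 1 \<and> s ` {1..q} \<subseteq> {1..} \<and> strict_mono_on {1..q} s \<and>
        t ` {1..q} \<subseteq> I \<and> (\<exists>j\<in>{1..q}. t j = zero_vec k)}"

text \<open>
  The sums lie in \<open>FIN k\<close>, so a colouring, which is only constrained on \<open>FIN k\<close>, is always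
  evaluated inside its domain.
\<close>

lemma T_le: "T i p x \<le> p x"
  by (simp add: T_def)

lemma T_vec_le: "T_vec k t p x \<le> p x"
proof (induction k arbitrary: p)
  case (Suc k)
  have "T_vec (Suc k) t p x \<le> T (t (Suc k)) p x" using Suc.IH by simp
  also have "\<dots> \<le> p x" by (rule T_le)
  finally show ?case .
qed simp

lemma T_vec_zero_vec: "T_vec k (zero_vec k) = id"
proof -
  have "\<forall>j\<in>{1..n}. t j = 0 \<Longrightarrow> T_vec n t = id" for n t
    by (induction n) (auto simp: T_def fun_eq_iff)
  then show ?thesis by (simp add: zero_vec_def)
qed

lemma block_sequence_supp_less:
  assumes b: "block_sequence k b" and k: "k \<ge> 1"
    and m: "1 \<le> m" "m < n" and x: "x \<in> supp (b m)" and y: "y \<in> supp (b n)"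
  shows "x < y"
proof -
  have fin: "finite (supp (b i))" and ne: "supp (b i) \<noteq> {}" if "i \<ge> 1" for i
  proof -
    have "b i \<in> FIN k" using b that by (simp add: block_sequence_def)
    then obtain x where "finite (supp (b i))" "b i x = k" by (auto simp: FIN_def)
    moreover from this have "x \<in> supp (b i)" using k by (simp add: supp_def)
    ultimately show "finite (supp (b i))" "supp (b i) \<noteq> {}" by auto
  qed
  have "n \<ge> 1 \<longrightarrow> Max (supp (b m)) < Min (supp (b n))"
    using \<open>m < n\<close>
  proof (induction n)
    case (Suc n)
    have step: "Max (supp (b i)) < Min (supp (b (Suc i)))" if "i \<ge> 1" for i
      using b that by (simp add: block_sequence_def)
    show ?case
    proof (cases "m = n")
      case True
      then show ?thesis using step m by simp
    next
      case False
      then have "m < n" "n \<ge> 1" using Suc.prems m by auto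
      then have "Max (supp (b m)) < Min (supp (b n))" using Suc.IH by simp
      also have "\<dots> \<le> Max (supp (b n))"
        using fin[OF \<open>n \<ge> 1\<close>] ne[OF \<open>n \<ge> 1\<close>] by simp
      also have "\<dots> < Min (supp (b (Suc n)))" using step \<open>n \<ge> 1\<close> by simp
      finally show ?thesis by simp
    qed
  qed simp
  moreover have "x \<le> Max (supp (b m))" using fin m x by simp
  moreover have "Min (supp (b n)) \<le> y" using fin m y by simp
  ultimately show ?thesis using m by linarith
qed

lemma block_span_subset_FIN:
  assumes b: "block_sequence k b" and k: "k \<ge> 1"
  shows "block_span k I b \<subseteq> FIN k"
proof
  fix p assume "p \<in> block_span k I b"
  then obtain q :: nat and s t j0 where p: "p = (\<lambda>x. \<Sum>j=1..q. T_vec k (t j) (b (s j)) x)"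
    and s: "s ` {1..q} \<subseteq> {1..}" and mono: "strict_mono_on {1..q} s"
    and j0: "j0 \<in> {1..q}" "t j0 = zero_vec k"
    unfolding block_span_def by blast
  have bF: "b (s j) \<in> FIN k" if "j \<in> {1..q}" for j
  proof -
    have "s j \<ge> 1" using s that by blast
    then show ?thesis using b by (simp add: block_sequence_def)
  qed
  have uniq: "i = j" if "i \<in> {1..q}" "j \<in> {1..q}" "b (s i) x \<noteq> 0" "b (s j) x \<noteq> 0" for i j x
  proof (rule ccontr)
    assume "i \<noteq> j"
    then have "s i < s j \<or> s j < s i"
      using strict_mono_onD[OF mono, of i j] strict_mono_onD[OF mono, of j i] that
      by (cases i j rule: linorder_cases) auto
    moreover have "s i \<ge> 1" "s j \<ge> 1" using s that by blast+
    moreover have "x \<in> supp (b (s i))" "x \<in> supp (b (s j))" using that by (auto simp: supp_def)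
    ultimately show False using block_sequence_supp_less[OF b k] less_irrefl by blast
  qed
  have val: "p x = T_vec k (t j) (b (s j)) x" if j: "j \<in> {1..q}" and nz: "b (s j) x \<noteq> 0" for j x
  proof -
    have "T_vec k (t i) (b (s i)) x = 0" if "i \<in> {1..q} - {j}" for i
    proof -
      have "b (s i) x = 0" using uniq j nz that by blast
      then show ?thesis using T_vec_le[of k "t i" "b (s i)" x] by simp
    qed
    then show ?thesis unfolding p using j by (subst sum.remove[of _ j]) auto
  qed
  have zero: "p x = 0" if "\<forall>j\<in>{1..q}. b (s j) x = 0" for x
  proof -
    have "T_vec k (t j) (b (s j)) x = 0" if "j \<in> {1..q}" for j
      using T_vec_le[of k "t j" "b (s j)" x] \<open>\<forall>j\<in>{1..q}. b (s j) x = 0\<close> that by simp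
    then show ?thesis by (simp add: p)
  qed
  have "p 0 = 0" using bF by (intro zero) (auto simp: FIN_def)
  moreover have "p x \<le> k" for x
  proof (cases "\<forall>j\<in>{1..q}. b (s j) x = 0")
    case False
    then obtain j where j: "j \<in> {1..q}" "b (s j) x \<noteq> 0" by blast
    then have "p x \<le> b (s j) x" using val T_vec_le by simp
    also have "\<dots> \<le> k" using bF[OF j(1)] by (simp add: FIN_def)
    finally show ?thesis .
  qed (use zero in simp)
  moreover have "finite (supp p)"
  proof (rule finite_subset)
    show "supp p \<subseteq> (\<Union>j\<in>{1..q}. supp (b (s j)))"
    proof
      fix x assume "x \<in> supp p"
      then have "p x \<noteq> 0" by (simp add: supp_def)
      then obtain j where "j \<in> {1..q}" "b (s j) x \<noteq> 0" using zero[of x] by metis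
      then show "x \<in> (\<Union>j\<in>{1..q}. supp (b (s j)))" by (intro UN_I[of j]) (auto simp: supp_def)
    qed
    show "finite (\<Union>j\<in>{1..q}. supp (b (s j)))" using bF by (auto simp: FIN_def)
  qed
  moreover have "\<exists>x. p x = k"
  proof -
    obtain x where x: "b (s j0) x = k" using bF[OF j0(1)] by (auto simp: FIN_def)
    then have "p x = k" using val[OF j0(1), of x] k j0(2) T_vec_zero_vec by simp
    then show ?thesis ..
  qed
  ultimately show "p \<in> FIN k" by (simp add: FIN_def)
qed

end

theory Submission
  imports Defs "HOL-Library.Function_Algebras"
begin

text \<open>
  The proof works in the compact right-topological semigroup of ultrafilters.  It suffices to
  find ultrafilters \<open>u 0, \<dots>, u k\<close>, with \<open>u j\<close> concentrated on \<open>FIN j\<close>, such that every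
  \<open>T i\<close> with \<open>1 \<le> i \<le> j\<close> maps \<open>u j\<close> to \<open>u (j - 1)\<close> and \<open>u i + u j = u (max i j)\<close>: these
  ultrafilters are then mapped to one another by all the maps \<open>T_vec k t\<close> and absorbed by
  \<open>u k\<close> on both sides, and the Galvin--Glazer argument applied to \<open>u k\<close> produces the sequence.

  Ultrafilters \<open>x 1, \<dots>, x k\<close> such that \<open>T i\<close> maps \<open>x j\<close> to \<open>x (j - 1)\<close> exist: if \<open>v\<close> is an
  idempotent on \<open>FIN 1\<close>, put \<open>x j = v + 2 v + \<dots> + j v\<close>; applying \<open>T i\<close> duplicates or deletes
  one summand, and duplicates merge by idempotence.  The families of this kind form a compact
  semigroup.  Absorption is then arranged level by level: if \<open>u 0, \<dots>, u m\<close> are as desired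
  and \<open>u 0, \<dots>, u m, x (m + 1), \<dots>, x k\<close> is a family consisting of idempotents, then replacing each
  \<open>x j\<close> by \<open>x j + \<dots> + x (m + 1) + u m\<close> gives another family, possibly not of idempotents, whose
  entry at \<open>m + 1\<close> absorbs \<open>u m\<close> on the right.  This is a closed condition, so some idempotent family
  satisfies it, and the mirror image of the construction yields absorption on the left.
\<close>

section \<open>Idempotents in compact semigroups\<close>

text \<open>Tychonoff's theorem. Ultrafilters are treated as points of such a product of two-point
  discrete spaces.\<close>

lemma compact_UNIV_bool_fun: "compact (UNIV :: ('a \<Rightarrow> bool) set)"
proof -
  have "compact (UNIV :: bool set)" by (rule finite_imp_compact) (rule finite)
  then have "compact_space (euclidean :: bool topology)"
    by (metis compact_space_def compactin_euclidean_iff topspace_euclidean)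
  then have "compact_space (product_topology (\<lambda>_ :: 'a. euclidean :: bool topology) UNIV)"
    by (intro compact_space_product_topology[THEN iffD2] disjI2 ballI)
  then have "compact_space (euclidean :: ('a \<Rightarrow> bool) topology)"
    by (subst (asm) euclidean_product_topology)
  then show ?thesis by (metis compact_space_def compactin_euclidean_iff topspace_euclidean)
qed

lemma compact_imp_closed_bool_fun:
  fixes S :: "('a \<Rightarrow> bool) set"
  assumes "compact S"
  shows "closed S"
proof -
  have "euclidean = discrete_topology (UNIV :: bool set)"
    by (intro topology_eq[THEN iffD2]) (simp add: open_discrete)
  then have "Hausdorff_space (euclidean :: bool topology)"
    by (metis Hausdorff_space_discrete_topology)
  then have "Hausdorff_space (product_topology (\<lambda>_ :: 'a. euclidean :: bool topology) UNIV)"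
    by (intro Hausdorff_space_product_topology[THEN iffD2] disjI2 ballI)
  then have "Hausdorff_space (euclidean :: ('a \<Rightarrow> bool) topology)"
    by (subst (asm) euclidean_product_topology)
  then have "closedin euclidean S"
    by (rule compactin_imp_closedin) (metis assms compactin_euclidean_iff)
  then show ?thesis by (metis closed_closedin)
qed

lemma closed_Collect_eq_bool_fun:
  fixes f g :: "'b::topological_space \<Rightarrow> 'a \<Rightarrow> bool"
  assumes "continuous_on UNIV f" "continuous_on UNIV g"
  shows "closed {x. f x = g x}"
proof -
  have "{x. f x = g x} = (\<Inter>A. {x. f x A = g x A})" by auto
  also have "closed \<dots>"
    by (intro closed_INT ballI closed_Collect_eq assms[THEN continuous_on_product_then_coordinatewise])
  finally show ?thesis .
qed

text \<open>The Ellis-Numakura lemma, with continuity in the left argument only. For an element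
  \<open>r\<close> of a minimal compact subsemigroup \<open>R\<close>, the image of \<open>R\<close>
  under right multiplication by \<open>r\<close> and then the stabilizer of \<open>r\<close> in
  \<open>R\<close> are compact subsemigroups, hence equal to \<open>R\<close>, and \<open>r\<close>
  is idempotent.\<close>

lemma compact_semigroup_idempotent:
  fixes f :: "('a \<Rightarrow> bool) \<Rightarrow> ('a \<Rightarrow> bool) \<Rightarrow> 'a \<Rightarrow> bool"
  assumes "compact S" "S \<noteq> {}"
    and closed: "\<And>x y. x \<in> S \<Longrightarrow> y \<in> S \<Longrightarrow> f x y \<in> S"
    and assoc: "\<And>x y z. x \<in> S \<Longrightarrow> y \<in> S \<Longrightarrow> z \<in> S \<Longrightarrow> f (f x y) z = f x (f y z)"
    and cont: "\<And>y. y \<in> S \<Longrightarrow> continuous_on S (\<lambda>x. f x y)"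
  shows "\<exists>e\<in>S. f e e = e"
proof -
  define sub where "sub R \<longleftrightarrow> R \<subseteq> S \<and> R \<noteq> {} \<and> compact R \<and> (\<forall>x\<in>R. \<forall>y\<in>R. f x y \<in> R)" for R
  have "sub S" using assms by (auto simp: sub_def)
  \<comment> \<open>Zorn's lemma gives maximal elements; passing to complements makes it yield a
    minimal compact subsemigroup.\<close>
  have "\<exists>M\<in>uminus ` Collect sub. \<forall>X\<in>uminus ` Collect sub. M \<subseteq> X \<longrightarrow> X = M"
  proof (rule subset_Zorn)
    fix \<C> assume chain: "subset.chain (uminus ` Collect sub) \<C>"
    show "\<exists>U\<in>uminus ` Collect sub. \<forall>X\<in>\<C>. X \<subseteq> U"
    proof (cases "\<C> = {}")
      case True
      have "- S \<in> uminus ` Collect sub" using \<open>sub S\<close> by simp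
      then show ?thesis using True by blast
    next
      case False
      define \<D> where "\<D> = uminus ` \<C>"
      have \<D>: "\<D> \<noteq> {}" "\<And>R. R \<in> \<D> \<Longrightarrow> sub R"
        using False chain by (auto simp: \<D>_def subset.chain_def)
      have lin: "R \<subseteq> R' \<or> R' \<subseteq> R" if "R \<in> \<D>" "R' \<in> \<D>" for R R'
      proof -
        have "- R \<in> \<C>" "- R' \<in> \<C>" using that unfolding \<D>_def by force+
        moreover have "\<forall>X\<in>\<C>. \<forall>Y\<in>\<C>. X \<subseteq> Y \<or> Y \<subseteq> X"
          using chain by (simp add: subset_chain_def)
        ultimately have "- R \<subseteq> - R' \<or> - R' \<subseteq> - R" by fast
        then show ?thesis by (metis Compl_subset_Compl_iff)
      qed
      obtain R0 where R0: "R0 \<in> \<D>" using \<D>(1) by blast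
      have cl: "closed R" if "R \<in> \<D>" for R
        using \<D>(2)[OF that] by (simp add: sub_def compact_imp_closed_bool_fun)
      \<comment> \<open>A finite subfamily of the chain together with \<open>R0\<close> has a least
        member, which is nonempty; compactness extends this to the whole chain.\<close>
      have "R0 \<inter> \<Inter>\<D> \<noteq> {}"
      proof (rule compact_imp_fip)
        show "compact R0" using \<D>(2)[OF R0] by (simp add: sub_def)
        fix F assume F: "finite F" "F \<subseteq> \<D>"
        have sub: "insert R0 F \<subseteq> \<D>" using F(2) R0 by simp
        have "subset.chain \<D> (insert R0 F)"
          unfolding subset_chain_def by (intro conjI ballI sub lin) (use sub in \<open>auto dest: subsetD\<close>)
        then have "\<Inter>(insert R0 F) \<in> insert R0 F"
          using F(1) by (intro Inter_in_chain) auto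
        then have "sub (\<Inter>(insert R0 F))" using sub \<D>(2) by (simp only: subsetD)
        then show "R0 \<inter> \<Inter>F \<noteq> {}" by (simp add: sub_def)
      qed (fact cl)
      moreover have "compact (R0 \<inter> \<Inter>\<D>)"
        using \<D>(2)[OF R0] cl by (intro compact_Int_closed closed_Inter) (auto simp: sub_def)
      moreover have "R0 \<inter> \<Inter>\<D> = \<Inter>\<D>" using R0 by blast
      moreover have "\<Inter>\<D> \<subseteq> S" using \<D>(2)[OF R0] R0 by (auto simp: sub_def)
      moreover have "f x y \<in> \<Inter>\<D>" if "x \<in> \<Inter>\<D>" "y \<in> \<Inter>\<D>" for x y
      proof
        fix R assume "R \<in> \<D>"
        with \<D>(2)[OF this] that show "f x y \<in> R" by (simp add: sub_def)
      qed
      ultimately have "sub (\<Inter>\<D>)" by (simp add: sub_def)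
      moreover have "X \<subseteq> - \<Inter>\<D>" if "X \<in> \<C>" for X
        using that by (auto simp: \<D>_def)
      ultimately show ?thesis by blast
    qed
  qed
  then obtain M where "M \<in> uminus ` Collect sub"
    and M: "\<forall>X\<in>uminus ` Collect sub. M \<subseteq> X \<longrightarrow> X = M" by blast
  obtain R where R: "sub R" and min: "\<And>R'. sub R' \<Longrightarrow> R' \<subseteq> R \<Longrightarrow> R' = R"
  proof -
    obtain R where R: "sub R" "M = - R" using \<open>M \<in> uminus ` Collect sub\<close> by auto
    have "R' = R" if "sub R'" "R' \<subseteq> R" for R'
    proof -
      have "- R' = M" using M R that by simp
      then show ?thesis using R by auto
    qed
    then show thesis using R that by blast
  qed
  then obtain r where r: "r \<in> R" by (auto simp: sub_def)
  have S: "x \<in> S" if "x \<in> R" for x using R that by (auto simp: sub_def)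
  have contR: "continuous_on R (\<lambda>x. f x r)"
    using cont[OF S[OF r]] R by (auto simp: sub_def intro: continuous_on_subset)
  have "sub ((\<lambda>x. f x r) ` R)"
    unfolding sub_def
  proof (intro conjI ballI)
    show "compact ((\<lambda>x. f x r) ` R)"
      using R contR by (intro compact_continuous_image) (auto simp: sub_def)
    fix x y assume "x \<in> (\<lambda>x. f x r) ` R" "y \<in> (\<lambda>x. f x r) ` R"
    then obtain x' y' where xy: "x' \<in> R" "x = f x' r" "y' \<in> R" "y = f y' r" by blast
    then have "f x y = f (f (f x' r) y') r" using assoc closed r S by simp
    moreover have "f (f x' r) y' \<in> R" using R xy r by (simp add: sub_def)
    ultimately show "f x y \<in> (\<lambda>x. f x r) ` R" by blast
  qed (use r R closed in \<open>auto simp: sub_def\<close>)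
  moreover have "(\<lambda>x. f x r) ` R \<subseteq> R" using R r by (auto simp: sub_def)
  ultimately have "(\<lambda>x. f x r) ` R = R" by (rule min)
  then obtain y where y: "y \<in> R" "f y r = r" using r by (metis imageE)
  have "sub {x \<in> R. f x r = r}"
    unfolding sub_def
  proof (intro conjI ballI)
    have "closedin (top_of_set R) (R \<inter> (\<lambda>x. f x r) -` {r})"
      by (intro continuous_closedin_preimage contR compact_imp_closed_bool_fun) simp
    then have "closedin (top_of_set R) {x \<in> R. f x r = r}" by (simp add: vimage_def Collect_conj_eq)
    then show "compact {x \<in> R. f x r = r}" using R closedin_compact by (auto simp: sub_def)
    fix x x' assume "x \<in> {x \<in> R. f x r = r}" "x' \<in> {x \<in> R. f x r = r}"
    then show "f x x' \<in> {x \<in> R. f x r = r}" using R r S assoc by (auto simp: sub_def)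
  qed (use y R in \<open>auto simp: sub_def\<close>)
  then have "{x \<in> R. f x r = r} = R" by (rule min) blast
  then show ?thesis using r S by blast
qed

section \<open>The semigroup of ultrafilters\<close>

text \<open>An ultrafilter is encoded by its indicator function, as a point of a product of copies
  of \<open>bool\<close>. The two conditions say that it is a homomorphism of Boolean algebras;
  upward closure and properness follow.\<close>

definition ultra :: "('a set \<Rightarrow> bool) \<Rightarrow> bool" where
  "ultra U \<longleftrightarrow> (\<forall>A. U (- A) \<longleftrightarrow> \<not> U A) \<and> (\<forall>A B. U (A \<inter> B) \<longleftrightarrow> U A \<and> U B)"

text \<open>The extension of addition to the Stone-Cech compactification, with the convention that
  is continuous in the left argument.\<close>

definition uplus :: "('a::semigroup_add set \<Rightarrow> bool) \<Rightarrow> ('a set \<Rightarrow> bool) \<Rightarrow> 'a set \<Rightarrow> bool"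
    (infixl "\<boxplus>" 65) where
  "(U \<boxplus> V) A \<longleftrightarrow> U {x. V {y. x + y \<in> A}}"

definition umap :: "('a \<Rightarrow> 'b) \<Rightarrow> ('a set \<Rightarrow> bool) \<Rightarrow> 'b set \<Rightarrow> bool" where
  "umap f U A \<longleftrightarrow> U (f -` A)"

lemma ultra_Int: "ultra U \<Longrightarrow> U (A \<inter> B) \<longleftrightarrow> U A \<and> U B"
  by (simp add: ultra_def)

lemma ultra_Compl: "ultra U \<Longrightarrow> U (- A) \<longleftrightarrow> \<not> U A"
  by (simp add: ultra_def)

lemma ultra_mono: "ultra U \<Longrightarrow> U A \<Longrightarrow> A \<subseteq> B \<Longrightarrow> U B"
  by (metis ultra_Int inf.absorb_iff1)

lemma ultra_UNIV: "ultra U \<Longrightarrow> U UNIV"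
  by (metis ultra_Compl ultra_mono subset_UNIV)

lemma ultra_nonempty: "ultra U \<Longrightarrow> U A \<Longrightarrow> \<exists>x. x \<in> A"
  by (metis ultra_Compl ultra_UNIV Compl_empty_eq equals0I)

lemma ultra_cong:
  assumes "ultra U" "U C" "\<And>x. x \<in> C \<Longrightarrow> x \<in> A \<longleftrightarrow> x \<in> B"
  shows "U A \<longleftrightarrow> U B"
proof -
  have "A \<inter> C = B \<inter> C" using assms(3) by blast
  then show ?thesis using ultra_Int[OF assms(1)] assms(2) by metis
qed

lemma ultra_INT:
  assumes "ultra U" "finite I" "\<And>i. i \<in> I \<Longrightarrow> U (A i)"
  shows "U (\<Inter>i\<in>I. A i)"
  using assms(2,3) by (induction I) (simp_all add: ultra_UNIV[OF assms(1)] ultra_Int[OF assms(1)])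

lemma ultra_uplus:
  assumes "ultra U" "ultra V"
  shows "ultra (U \<boxplus> V)"
proof -
  have "U {x. V {y. x + y \<in> - A}} \<longleftrightarrow> \<not> U {x. V {y. x + y \<in> A}}" for A
  proof -
    have "V {y. x + y \<in> - A} \<longleftrightarrow> \<not> V {y. x + y \<in> A}" for x
      using ultra_Compl[OF assms(2), of "{y. x + y \<in> A}"] by (simp add: Collect_neg_eq)
    then show ?thesis
      using ultra_Compl[OF assms(1), of "{x. V {y. x + y \<in> A}}"] by (simp add: Collect_neg_eq)
  qed
  moreover have "U {x. V {y. x + y \<in> A \<inter> B}} \<longleftrightarrow>
      U {x. V {y. x + y \<in> A}} \<and> U {x. V {y. x + y \<in> B}}" for A B
  proof -
    have "V {y. x + y \<in> A \<inter> B} \<longleftrightarrow> V {y. x + y \<in> A} \<and> V {y. x + y \<in> B}" for x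
      using ultra_Int[OF assms(2), of "{y. x + y \<in> A}" "{y. x + y \<in> B}"]
      by (simp add: Collect_conj_eq)
    then show ?thesis
      using ultra_Int[OF assms(1), of "{x. V {y. x + y \<in> A}}" "{x. V {y. x + y \<in> B}}"]
      by (simp add: Collect_conj_eq)
  qed
  ultimately show ?thesis unfolding ultra_def uplus_def by blast
qed

lemma ultra_umap: "ultra U \<Longrightarrow> ultra (umap f U)"
  by (simp add: ultra_def umap_def vimage_Compl)

lemma ultra_principal: "ultra (\<lambda>A. x \<in> A)"
  by (simp add: ultra_def)

lemma uplus_assoc: "U \<boxplus> V \<boxplus> W = U \<boxplus> (V \<boxplus> W)"
  by (simp add: fun_eq_iff uplus_def add.assoc)

lemma umap_umap: "umap f (umap g U) = umap (f \<circ> g) U"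
  by (simp add: fun_eq_iff umap_def vimage_comp)

text \<open>Evaluated at \<open>A\<close>, the sum is the coordinate of \<open>U\<close> at a set
  determined by \<open>V\<close> and \<open>A\<close>.\<close>

lemma continuous_uplus: "continuous_on S (\<lambda>U. U \<boxplus> V)"
proof -
  have "continuous_on UNIV (\<lambda>U. (U \<boxplus> V) A)" for A
    unfolding uplus_def by simp
  then have "continuous_on UNIV (\<lambda>U. U \<boxplus> V)"
    by (rule continuous_on_coordinatewise_then_product)
  then show ?thesis by (rule continuous_on_subset) simp
qed

lemma continuous_umap: "continuous_on S (umap f)"
proof -
  have "continuous_on UNIV (\<lambda>U. umap f U A)" for A
    unfolding umap_def by simp
  then have "continuous_on UNIV (umap f)"
    by (rule continuous_on_coordinatewise_then_product)
  then show ?thesis by (rule continuous_on_subset) simp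
qed

lemma closed_Collect_coordinate: "closed {U :: 'a \<Rightarrow> bool. U x}" "closed {U :: 'a \<Rightarrow> bool. \<not> U x}"
proof -
  have "closed ((\<lambda>U :: 'a \<Rightarrow> bool. U x) -` B)" for B
    by (rule closed_vimage) (simp_all add: closed_def open_discrete)
  from this[of "{True}"] this[of "{False}"]
  show "closed {U :: 'a \<Rightarrow> bool. U x}" "closed {U :: 'a \<Rightarrow> bool. \<not> U x}"
    by (simp_all add: vimage_def)
qed

lemma closed_Collect_ultra: "closed {U. ultra U}"
proof -
  have "{U. ultra U} = {U. (\<forall>A. (U (- A) \<or> U A) \<and> (\<not> U (- A) \<or> \<not> U A)) \<and>
      (\<forall>A B. (U (A \<inter> B) \<or> \<not> U A \<or> \<not> U B) \<and> (\<not> U (A \<inter> B) \<or> U A) \<and> (\<not> U (A \<inter> B) \<or> U B))}"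
    unfolding ultra_def by (rule Collect_cong) meson
  also have "closed \<dots>"
    by (intro closed_Collect_conj closed_Collect_all closed_Collect_disj closed_Collect_coordinate)
  finally show ?thesis .
qed

section \<open>Ultrafilters on finitely supported functions\<close>

text \<open>An ultrafilter in \<open>ultra_FIN j\<close> contains every \<open>vanishing n\<close>.  The maps \<open>T i\<close> are not
  additive, but they preserve sums of functions with disjoint supports, and hence they become
  homomorphisms on such ultrafilters.\<close>

definition vanishing :: "nat \<Rightarrow> (nat \<Rightarrow> nat) set" where
  "vanishing n = {p. \<forall>x\<le>n. p x = 0}"

definition ultra_FIN :: "nat \<Rightarrow> ((nat \<Rightarrow> nat) set \<Rightarrow> bool) set" where
  "ultra_FIN j = {U. ultra U \<and> U (FIN j) \<and> (\<forall>n. U (vanishing n))}"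

lemma compact_ultra_FIN: "compact (ultra_FIN j)"
proof -
  have "closed (ultra_FIN j)"
    unfolding ultra_FIN_def
    by (intro closed_Collect_conj closed_Collect_all closed_Collect_coordinate closed_Collect_ultra)
  then show ?thesis using compact_Int_closed[OF compact_UNIV_bool_fun] by fastforce
qed

lemma FIN_bounded:
  assumes "p \<in> FIN j"
  obtains n where "\<And>x. n < x \<Longrightarrow> p x = 0"
proof -
  have "finite (supp p)" using assms by (simp add: FIN_def)
  then obtain n where "\<forall>x\<in>supp p. x \<le> n" using finite_nat_set_iff_bounded_le by blast
  then have "p x = 0" if "n < x" for x using that by (force simp: supp_def)
  then show thesis by (rule that)
qed

lemma FIN_add:
  assumes p: "p \<in> FIN i" and n: "\<And>x. n < x \<Longrightarrow> p x = 0" and q: "q \<in> FIN j" "q \<in> vanishing n"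
  shows "p + q \<in> FIN (max i j)"
proof -
  have val: "(p + q) x = (if x \<le> n then p x else q x)" for x
    using n[of x] q(2) by (auto simp: vanishing_def)
  have "(p + q) x \<le> max i j" for x
    unfolding val using p q(1) by (auto simp: FIN_def le_max_iff_disj)
  moreover have "finite (supp (p + q))"
    by (rule finite_subset[of _ "supp p \<union> supp q"]) (use p q in \<open>auto simp: supp_def FIN_def\<close>)
  moreover have "\<exists>x. (p + q) x = max i j"
  proof (cases "max i j = 0")
    case True
    then show ?thesis using p q by (intro exI[of _ 0]) (auto simp: FIN_def)
  next
    case False
    obtain x y where x: "p x = i" and y: "q y = j" using p q by (auto simp: FIN_def)
    have "(p + q) x = i" if "i > 0" unfolding val using x n[of x] that by force
    moreover have "(p + q) y = j" if "j > 0" unfolding val using y q(2) that by (auto simp: vanishing_def)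
    ultimately show ?thesis using False by (metis max_def gr0I)
  qed
  moreover have "(p + q) 0 = 0" using p q by (auto simp: FIN_def)
  ultimately show ?thesis by (simp add: FIN_def)
qed

lemma ultra_FIN_uplus:
  assumes "U \<in> ultra_FIN i" "V \<in> ultra_FIN j"
  shows "U \<boxplus> V \<in> ultra_FIN (max i j)"
proof -
  have U: "ultra U" "U (FIN i)" "\<And>n. U (vanishing n)" and V: "ultra V" "V (FIN j)" "\<And>n. V (vanishing n)"
    using assms by (auto simp: ultra_FIN_def)
  have "V {q. p + q \<in> FIN (max i j)}" if p: "p \<in> FIN i" for p
  proof -
    obtain n where "\<And>x. n < x \<Longrightarrow> p x = 0" using FIN_bounded[OF p] by blast
    then have "FIN j \<inter> vanishing n \<subseteq> {q. p + q \<in> FIN (max i j)}" using FIN_add[OF p] by auto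
    moreover have "V (FIN j \<inter> vanishing n)" using V ultra_Int by blast
    ultimately show ?thesis using V(1) ultra_mono by blast
  qed
  then have "FIN i \<subseteq> {p. V {q. p + q \<in> FIN (max i j)}}" by blast
  then have "(U \<boxplus> V) (FIN (max i j))" unfolding uplus_def using U ultra_mono by blast
  moreover have "(U \<boxplus> V) (vanishing n)" for n
  proof -
    have "V {q. p + q \<in> vanishing n}" if "p \<in> vanishing n" for p
      by (rule ultra_mono[OF V(1) V(3)[of n]]) (use that in \<open>auto simp: vanishing_def\<close>)
    then have "vanishing n \<subseteq> {p. V {q. p + q \<in> vanishing n}}" by blast
    then show ?thesis unfolding uplus_def using U ultra_mono by blast
  qed
  ultimately show ?thesis using ultra_uplus[OF U(1) V(1)] by (simp add: ultra_FIN_def)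
qed

text \<open>Both \<open>T i\<close> and multiplication by a constant change only the values of a
  function, so they are postcompositions and this covers both.\<close>

lemma umap_comp_ultra_FIN:
  fixes f :: "nat \<Rightarrow> nat"
  assumes "U \<in> ultra_FIN i" "f 0 = 0" "\<And>v. v \<le> i \<Longrightarrow> f v \<le> j" "f i = j"
  shows "umap ((\<circ>) f) U \<in> ultra_FIN j"
proof -
  have U: "ultra U" "U (FIN i)" "\<And>n. U (vanishing n)" using assms by (auto simp: ultra_FIN_def)
  have "finite (supp (f \<circ> p))" if "finite (supp p)" for p
    by (rule finite_subset[OF _ that]) (use assms(2) in \<open>auto simp: supp_def, metis gr0I\<close>)
  then have "FIN i \<subseteq> (\<circ>) f -` FIN j" using assms(2-4) by (auto simp: FIN_def)
  moreover have "vanishing n \<subseteq> (\<circ>) f -` vanishing n" for n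
    using assms(2) by (auto simp: vanishing_def)
  ultimately have "umap ((\<circ>) f) U (FIN j)" "umap ((\<circ>) f) U (vanishing n)" for n
    unfolding umap_def using U ultra_mono[OF U(1)] by blast+
  then show ?thesis using ultra_umap[OF U(1)] by (simp add: ultra_FIN_def)
qed

text \<open>For fixed \<open>p\<close>, \<open>V\<close>-almost every \<open>q\<close> has support
  beyond that of \<open>p\<close>. At each point one summand is then 0, and there
  \<open>f 0 = 0\<close> makes \<open>f\<close> additive.\<close>

lemma umap_comp_uplus:
  fixes f :: "nat \<Rightarrow> nat"
  assumes "U \<in> ultra_FIN i" "V \<in> ultra_FIN j" "f 0 = 0"
  shows "umap ((\<circ>) f) (U \<boxplus> V) = umap ((\<circ>) f) U \<boxplus> umap ((\<circ>) f) V"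
proof
  fix A
  have U: "ultra U" "U (FIN i)" and V: "ultra V" "\<And>n. V (vanishing n)"
    using assms by (auto simp: ultra_FIN_def)
  have "U {p. V {q. f \<circ> (p + q) \<in> A}} \<longleftrightarrow> U {p. V {q. (f \<circ> p) + (f \<circ> q) \<in> A}}"
  proof (rule ultra_cong[OF U])
    fix p assume "p \<in> FIN i"
    then obtain n where n: "\<And>x. n < x \<Longrightarrow> p x = 0" using FIN_bounded by blast
    have "V {q. f \<circ> (p + q) \<in> A} \<longleftrightarrow> V {q. (f \<circ> p) + (f \<circ> q) \<in> A}"
    proof (rule ultra_cong[OF V])
      fix q assume "q \<in> vanishing n"
      then have "f (p x + q x) = f (p x) + f (q x)" for x
        using n[of x] assms(3) by (cases "x \<le> n") (auto simp: vanishing_def)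
      then have "f \<circ> (p + q) = (f \<circ> p) + (f \<circ> q)" by (simp add: fun_eq_iff)
      then show "q \<in> {q. f \<circ> (p + q) \<in> A} \<longleftrightarrow> q \<in> {q. (f \<circ> p) + (f \<circ> q) \<in> A}" by simp
    qed
    then show "p \<in> {p. V {q. f \<circ> (p + q) \<in> A}} \<longleftrightarrow> p \<in> {p. V {q. (f \<circ> p) + (f \<circ> q) \<in> A}}" by simp
  qed
  then show "umap ((\<circ>) f) (U \<boxplus> V) A \<longleftrightarrow> (umap ((\<circ>) f) U \<boxplus> umap ((\<circ>) f) V) A"
    by (simp add: umap_def uplus_def vimage_def)
qed

lemma ultra_FIN_1_nonempty: "ultra_FIN 1 \<noteq> {}"
proof -
  define S where "S = {U :: (nat \<Rightarrow> nat) set \<Rightarrow> bool. ultra U \<and> U (FIN 1)}"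
  have "closed S" unfolding S_def
    by (intro closed_Collect_conj closed_Collect_coordinate closed_Collect_ultra)
  then have "compact S" using compact_Int_closed[OF compact_UNIV_bool_fun] by fastforce
  then have "S \<inter> (\<Inter>n\<in>UNIV. {U. U (vanishing n)}) \<noteq> {}"
  proof (rule compact_imp_fip_image)
    fix I :: "nat set" assume "finite I"
    then obtain N where N: "\<forall>n\<in>I. n < N" using finite_nat_set_iff_bounded by blast
    \<comment> \<open>The point lies beyond all indices in \<open>I\<close> and is never 0, where
      elements of \<open>FIN 1\<close> must vanish.\<close>
    define p where "p = (\<lambda>x. if x = Suc N then 1 else (0 :: nat))"
    have "supp p = {Suc N}" by (auto simp: supp_def p_def)
    then have "p \<in> FIN 1" by (auto simp: FIN_def p_def)
    moreover have "p \<in> vanishing n" if "n \<in> I" for n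
      using that N by (auto simp: vanishing_def p_def)
    ultimately have "(\<lambda>A. p \<in> A) \<in> S \<inter> (\<Inter>n\<in>I. {U. U (vanishing n)})"
      by (simp add: S_def ultra_principal)
    then show "S \<inter> (\<Inter>n\<in>I. {U. U (vanishing n)}) \<noteq> {}" by blast
  qed (rule closed_Collect_coordinate)
  then show ?thesis by (auto simp: S_def ultra_FIN_def)
qed

section \<open>The maps \<open>T i\<close> on ultrafilters\<close>

abbreviation lower :: "nat \<Rightarrow> ((nat \<Rightarrow> nat) set \<Rightarrow> bool) \<Rightarrow> (nat \<Rightarrow> nat) set \<Rightarrow> bool" where
  "lower i \<equiv> umap (T i)"

lemma T_eq_comp: "T i = (\<circ>) (\<lambda>v. if i = 0 \<or> v < i then v else v - 1)"
  by (auto simp: T_def fun_eq_iff)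

lemma lower_ultra_FIN: "U \<in> ultra_FIN j \<Longrightarrow> i \<in> {1..j} \<Longrightarrow> lower i U \<in> ultra_FIN (j - 1)"
  unfolding T_eq_comp by (rule umap_comp_ultra_FIN) auto

text \<open>No value of a function in \<open>FIN j\<close> reaches an index \<open>i > j\<close>.
  The case \<open>i = j + 1\<close> is what duplicates a summand in the sums below.\<close>

lemma lower_id:
  assumes "U \<in> ultra_FIN j" "i = 0 \<or> j < i"
  shows "lower i U = U"
proof
  fix A
  have "U (T i -` A) \<longleftrightarrow> U A"
  proof (rule ultra_cong)
    fix p assume "p \<in> FIN j"
    then have "p x < i" if "i \<noteq> 0" for x using assms(2) that by (auto simp: FIN_def intro: le_less_trans)
    then have "T i p = p" by (simp add: T_def fun_eq_iff)
    then show "p \<in> T i -` A \<longleftrightarrow> p \<in> A" by simp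
  qed (use assms in \<open>auto simp: ultra_FIN_def\<close>)
  then show "lower i U A = U A" by (simp add: umap_def)
qed

lemma lower_uplus: "U \<in> ultra_FIN j \<Longrightarrow> V \<in> ultra_FIN j' \<Longrightarrow> lower i (U \<boxplus> V) = lower i U \<boxplus> lower i V"
  unfolding T_eq_comp by (rule umap_comp_uplus) auto

lemma ultra_FIN_uplus_same: "U \<in> ultra_FIN j \<Longrightarrow> V \<in> ultra_FIN j \<Longrightarrow> U \<boxplus> V \<in> ultra_FIN j"
  using ultra_FIN_uplus by (metis max.idem)

lemma ultra_FIN_0_idem:
  assumes "U \<in> ultra_FIN 0"
  shows "U \<boxplus> U = U"
proof
  fix A
  have U: "ultra U" "U (FIN 0)" using assms by (auto simp: ultra_FIN_def)
  have zero: "x = 0" if "x \<in> FIN 0" for x :: "nat \<Rightarrow> nat"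
    using that by (simp add: FIN_def fun_eq_iff)
  have "U {x. U {y. x + y \<in> A}} \<longleftrightarrow> U {x. U A}"
    by (rule ultra_cong[OF U]) (auto dest!: zero)
  also have "\<dots> \<longleftrightarrow> U A"
    using ultra_UNIV[OF U(1)] ultra_nonempty[OF U(1), of "{}"] by (cases "U A") auto
  finally show "(U \<boxplus> U) A = U A" by (simp add: uplus_def)
qed

lemma ultra_FIN_idempotent:
  assumes "S \<subseteq> ultra_FIN K" "compact S" "S \<noteq> {}" "\<And>x y. x \<in> S \<Longrightarrow> y \<in> S \<Longrightarrow> x \<boxplus> y \<in> S"
  obtains e where "e \<in> S" "e \<boxplus> e = e"
proof -
  have "\<exists>e\<in>S. e \<boxplus> e = e"
    using assms(2-) by (rule compact_semigroup_idempotent) (simp_all only: uplus_assoc continuous_uplus)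
  then show thesis using that by blast
qed

section \<open>Coherent families\<close>

text \<open>A family \<open>x 0, \<dots>, x K\<close> with \<open>x j\<close> the image of \<open>x (j + 1)\<close> under \<open>T 1\<close> is encoded by its
  top entry \<open>x K\<close>, so that no product of semigroups is needed; \<open>layer K j\<close> recovers \<open>x j\<close>.\<close>

definition layer :: "nat \<Rightarrow> nat \<Rightarrow> ((nat \<Rightarrow> nat) set \<Rightarrow> bool) \<Rightarrow> (nat \<Rightarrow> nat) set \<Rightarrow> bool" where
  "layer K j = lower 1 ^^ (K - j)"

lemma layer_top: "layer K K x = x"
  by (simp add: layer_def)

lemma lower_layer: "j < K \<Longrightarrow> lower 1 (layer K (Suc j) x) = layer K j x"
  by (simp add: layer_def flip: Suc_diff_Suc)

lemma layer_layer: "j \<le> m \<Longrightarrow> m \<le> K \<Longrightarrow> layer m j (layer K m x) = layer K j x"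
proof -
  assume "j \<le> m" "m \<le> K"
  then have "K - j = (m - j) + (K - m)" by simp
  then show ?thesis by (simp only: layer_def funpow_add comp_apply)
qed

lemma layer_ultra_FIN: "j \<le> K \<Longrightarrow> x \<in> ultra_FIN K \<Longrightarrow> layer K j x \<in> ultra_FIN j"
proof (induction j rule: inc_induct)
  case (step j)
  then show ?case using lower_ultra_FIN[of "layer K (Suc j) x" "Suc j" 1] lower_layer[of j K x] by simp
qed (simp add: layer_top)

lemma layer_uplus:
  assumes "x \<in> ultra_FIN K" "y \<in> ultra_FIN K"
  shows "j \<le> K \<Longrightarrow> layer K j (x \<boxplus> y) = layer K j x \<boxplus> layer K j y"
proof (induction j rule: inc_induct)
  case (step j)
  then have "layer K (Suc j) x \<in> ultra_FIN (Suc j)" "layer K (Suc j) y \<in> ultra_FIN (Suc j)"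
    using assms layer_ultra_FIN by auto
  then have "lower 1 (layer K (Suc j) x \<boxplus> layer K (Suc j) y) =
      lower 1 (layer K (Suc j) x) \<boxplus> lower 1 (layer K (Suc j) y)" by (rule lower_uplus)
  then show ?case using step.IH lower_layer[OF step(2)] by metis
qed (simp add: layer_top)

lemma continuous_layer: "continuous_on UNIV (layer K j)"
proof -
  have "continuous_on UNIV (lower 1 ^^ n)" for n
  proof (induction n)
    case (Suc n)
    then show ?case
      using continuous_on_compose[OF Suc continuous_umap] by simp
  qed (simp add: id_def)
  then show ?thesis by (simp add: layer_def)
qed

text \<open>Recovers a family given entry by entry from its top entry, once consecutive entries are
  linked by \<open>T 1\<close>.\<close>

lemma layer_eqI:
  assumes "\<And>j. m \<le> j \<Longrightarrow> j < K \<Longrightarrow> lower 1 (y (Suc j)) = y j"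
  shows "j \<le> K \<Longrightarrow> m \<le> j \<Longrightarrow> layer K j (y K) = y j"
proof (induction j rule: inc_induct)
  case (step j)
  then have "layer K (Suc j) (y K) = y (Suc j)" "lower 1 (y (Suc j)) = y j" using assms[of j] by simp_all
  then show ?case using lower_layer[OF step(2), of "y K"] by simp
qed (simp add: layer_top)

text \<open>The layers are defined through \<open>T 1\<close>; coherence demands that every other
  admissible \<open>T i\<close> acts on them in the same way.\<close>

definition coherent :: "nat \<Rightarrow> ((nat \<Rightarrow> nat) set \<Rightarrow> bool) set" where
  "coherent K = {x \<in> ultra_FIN K. \<forall>j\<in>{1..K}. \<forall>i\<in>{1..j}. lower i (layer K j x) = layer K (j - 1) x}"

lemma coherent_ultra_FIN: "x \<in> coherent K \<Longrightarrow> x \<in> ultra_FIN K"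
  by (simp add: coherent_def)

lemma compact_coherent: "compact (coherent K)"
proof -
  have "closed {x. lower i (layer K j x) = layer K j' x}" for i j j'
    using continuous_on_compose[OF continuous_layer continuous_umap] continuous_layer
    by (intro closed_Collect_eq_bool_fun) (simp_all add: comp_def)
  then have "closed {x. \<forall>j\<in>{1..K}. \<forall>i\<in>{1..j}. lower i (layer K j x) = layer K (j - 1) x}"
    by (simp add: Collect_ball_eq closed_INT)
  from compact_Int_closed[OF compact_ultra_FIN[of K] this] show ?thesis
    by (simp add: coherent_def Collect_conj_eq)
qed

lemma coherent_uplus:
  assumes "x \<in> coherent K" "y \<in> coherent K"
  shows "x \<boxplus> y \<in> coherent K"
proof -
  have xy: "x \<in> ultra_FIN K" "y \<in> ultra_FIN K" using assms by (simp_all add: coherent_def)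
  have "lower i (layer K j (x \<boxplus> y)) = layer K (j - 1) (x \<boxplus> y)" if "j \<in> {1..K}" "i \<in> {1..j}" for i j
  proof -
    have "lower i (layer K j (x \<boxplus> y)) = lower i (layer K j x) \<boxplus> lower i (layer K j y)"
      using layer_ultra_FIN[of j K x] layer_ultra_FIN[of j K y] xy that
      by (simp add: layer_uplus lower_uplus[of _ j _ j])
    also have "\<dots> = layer K (j - 1) (x \<boxplus> y)"
      using assms that xy by (simp add: coherent_def layer_uplus)
    finally show ?thesis .
  qed
  then show ?thesis using ultra_FIN_uplus_same[OF xy] by (simp add: coherent_def)
qed

lemma coherent_nonempty: "coherent K \<noteq> {}"
proof -
  obtain u where u: "u \<in> ultra_FIN 1" "u \<boxplus> u = u"
    using ultra_FIN_idempotent[OF subset_refl compact_ultra_FIN ultra_FIN_1_nonempty ultra_FIN_uplus_same] by blast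
  \<comment> \<open>This is the ultrafilter written \<open>j v\<close> in the overview;
    \<open>M 0\<close> is concentrated on the zero function.\<close>
  define M where "M j = umap ((\<circ>) (\<lambda>v. j * v)) u" for j :: nat
  have M_ultra_FIN: "M j \<in> ultra_FIN j" for j
    unfolding M_def by (rule umap_comp_ultra_FIN[OF u(1)]) auto
  have M_idem: "M j \<boxplus> M j = M j" for j
    using umap_comp_uplus[OF u(1) u(1), of "\<lambda>v. j * v"] u(2) by (simp add: M_def)
  \<comment> \<open>Under \<open>M j\<close> almost every function takes only the values 0 and
    \<open>j\<close>, and every \<open>i\<close> from 1 to \<open>j\<close> lowers \<open>j\<close>
    to \<open>j - 1\<close> and keeps 0.\<close>
  have lower_M: "lower i (M j) = M (j - 1)" if "i \<in> {1..j}" for i j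
  proof
    fix A
    have "u ((T i \<circ> (\<circ>) ((*) j)) -` A) \<longleftrightarrow> u ((\<circ>) ((*) (j - 1)) -` A)"
    proof (rule ultra_cong)
      fix p assume "p \<in> FIN 1"
      then have v: "p x = 0 \<or> p x = 1" for x by (auto simp: FIN_def le_Suc_eq)
      have "T i (\<lambda>x. j * p x) x = (j - 1) * p x" for x
        using that v[of x] by (elim disjE) (auto simp: T_def)
      then have "T i ((*) j \<circ> p) = (*) (j - 1) \<circ> p" by (auto simp: fun_eq_iff comp_def)
      then show "p \<in> (T i \<circ> (\<circ>) ((*) j)) -` A \<longleftrightarrow> p \<in> (\<circ>) ((*) (j - 1)) -` A" by simp
    qed (use u in \<open>auto simp: ultra_FIN_def\<close>)
    then show "lower i (M j) A = M (j - 1) A"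
      by (simp add: M_def umap_umap umap_def)
  qed
  define y where "y = rec_nat (M 0) (\<lambda>j v. v \<boxplus> M (Suc j))"
  have y_0: "y 0 = M 0" and y_Suc: "y (Suc j) = y j \<boxplus> M (Suc j)" for j
    by (simp_all add: y_def)
  have y_ultra_FIN: "y j \<in> ultra_FIN j" for j
  proof (induction j)
    case (Suc j)
    then show ?case using ultra_FIN_uplus[OF Suc M_ultra_FIN[of "Suc j"]] by (simp add: y_Suc)
  qed (simp add: y_0 M_ultra_FIN)
  have y_M: "y j \<boxplus> M j = y j" for j
    by (cases j) (simp_all add: y_0 y_Suc M_idem uplus_assoc)
  have lower_y: "lower i (y j) = y (j - 1)" if "i \<in> {1..j}" for i j
    using that
  proof (induction j)
    case (Suc j)
    have "lower i (y (Suc j)) = lower i (y j) \<boxplus> M j"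
      using lower_uplus[OF y_ultra_FIN M_ultra_FIN] lower_M[OF Suc.prems] by (simp add: y_Suc)
    \<comment> \<open>For \<open>i = Suc j\<close> the first term is unchanged and its last summand
      absorbs the extra \<open>M j\<close>. For smaller \<open>i\<close> the first term drops to
      \<open>y (j - 1)\<close>, and \<open>M j\<close> completes it to \<open>y j\<close>.\<close>
    also have "\<dots> = y j"
    proof (cases "i = Suc j")
      case True
      then show ?thesis using lower_id[OF y_ultra_FIN] y_M by simp
    next
      case False
      then have "i \<in> {1..j}" using Suc.prems by auto
      then show ?thesis using Suc.IH by (cases j) (simp_all add: y_Suc)
    qed
    finally show ?case by simp
  qed simp
  have "layer K j (y K) = y j" if "j \<le> K" for j
    by (rule layer_eqI[of 0]) (use that lower_y in auto)
  then have "lower i (layer K j (y K)) = layer K (j - 1) (y K)" if "j \<in> {1..K}" "i \<in> {1..j}" for i j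
    using that lower_y by simp
  then have "y K \<in> coherent K" using y_ultra_FIN by (simp add: coherent_def)
  then show ?thesis by blast
qed

text \<open>The operation \<open>f\<close> is the addition or its opposite, which covers both staircases
  \<open>x j + \<dots> + x (m + 1) + x m\<close> and \<open>x m + x (m + 1) + \<dots> + x j\<close>.\<close>

lemma staircase:
  assumes f: "f = (\<boxplus>) \<or> f = (\<lambda>a b. b \<boxplus> a)" and m: "m < K"
    and e: "e \<in> coherent K" "e \<boxplus> e = e"
    and absorb: "\<And>i. i \<le> m \<Longrightarrow> f (layer K m e) (layer K i e) = layer K m e"
  shows "\<exists>y\<in>coherent K. (\<forall>j\<le>m. layer K j y = layer K j e) \<and>
           layer K (Suc m) y = f (layer K (Suc m) e) (layer K m e)"
proof -
  define c where "c j = layer K j e" for j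
  have c_ultra_FIN: "c j \<in> ultra_FIN j" if "j \<le> K" for j
    using layer_ultra_FIN[OF that] e(1) by (simp add: c_def coherent_ultra_FIN)
  have lower_c: "lower i (c j) = c (j - 1)" if "i \<in> {1..j}" "j \<le> K" for i j
    using e(1) that by (simp add: c_def coherent_def)
  have c_idem: "f (c j) (c j) = c j" if "j \<le> K" for j
    using f layer_uplus[OF coherent_ultra_FIN[OF e(1)] coherent_ultra_FIN[OF e(1)] that] e(2) by (auto simp: c_def)
  have f_assoc: "f (f U V) W = f U (f V W)" for U V W
    using f by (auto simp: uplus_assoc)
  have f_ultra_FIN: "f U V \<in> ultra_FIN (max i j)" if "U \<in> ultra_FIN i" "V \<in> ultra_FIN j" for U V i j
    using f ultra_FIN_uplus that by (metis max.commute)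
  have lower_f: "lower n (f U V) = f (lower n U) (lower n V)" if "U \<in> ultra_FIN i" "V \<in> ultra_FIN j" for U V i j n
    using f lower_uplus that by metis
  \<comment> \<open>\<open>g d\<close> is the new entry at level \<open>m + d\<close>, with
    \<open>c (m + d)\<close> as outermost summand and \<open>c m\<close> as innermost.\<close>
  define g where "g = rec_nat (c m) (\<lambda>d v. f (c (m + Suc d)) v)"
  have g_0: "g 0 = c m" and g_Suc: "g (Suc d) = f (c (m + Suc d)) (g d)" for d
    by (simp_all add: g_def)
  have g_ultra_FIN: "g d \<in> ultra_FIN (m + d)" if "m + d \<le> K" for d
    using that
  proof (induction d)
    case (Suc d)
    then show ?case using f_ultra_FIN[OF c_ultra_FIN[of "m + Suc d"], of "g d" "m + d"] by (simp add: g_Suc max_def)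
  qed (use c_ultra_FIN m in \<open>simp add: g_0\<close>)
  \<comment> \<open>The index \<open>i\<close> may exceed the level \<open>m + d\<close> by one,
    since this is applied one level below the entry to be lowered. For that index \<open>g d\<close>
    is fixed and its outermost summand merges with the added copy; for smaller \<open>i\<close> and
    positive \<open>d\<close>, lowering leaves \<open>g (d - 1)\<close> and the added copy restores
    \<open>g d\<close>.\<close>
  have key: "f (c (m + d)) (lower i (g d)) = g d" if "m + d \<le> K" "i \<in> {1..Suc (m + d)}" for d i
    using that
  proof (induction d arbitrary: i)
    case 0
    show ?case
    proof (cases "i = Suc m")
      case True
      then show ?thesis using lower_id[OF c_ultra_FIN[of m], of i] c_idem[of m] m by (simp add: g_0)
    next
      case False
      \<comment> \<open>Here \<open>T i\<close> lowers \<open>c m\<close> itself, and the result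
        \<open>c (m - 1)\<close> is absorbed by hypothesis.\<close>
      then have "lower i (c m) = c (m - 1)" using 0 m by (intro lower_c) auto
      then show ?thesis using absorb[of "m - 1"] by (simp add: g_0 c_def)
    qed
  next
    case (Suc d)
    show ?case
    proof (cases "i = Suc (m + Suc d)")
      case True
      then have "lower i (g (Suc d)) = g (Suc d)" using g_ultra_FIN[OF Suc.prems(1)] by (intro lower_id) auto
      then show ?thesis using c_idem[OF Suc.prems(1)] by (simp add: g_Suc flip: f_assoc)
    next
      case False
      then have i: "i \<in> {1..Suc (m + d)}" using Suc.prems by auto
      have "lower i (g (Suc d)) = f (lower i (c (m + Suc d))) (lower i (g d))"
        unfolding g_Suc using Suc.prems by (intro lower_f[OF c_ultra_FIN g_ultra_FIN]) auto
      also have "\<dots> = f (c (m + d)) (lower i (g d))" using lower_c[of i "m + Suc d"] i Suc.prems by simp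
      also have "\<dots> = g d" using Suc.IH i Suc.prems by simp
      finally show ?thesis by (simp add: g_Suc)
    qed
  qed
  have lower_g: "lower i (g (Suc d)) = g d" if "m + Suc d \<le> K" "i \<in> {1..m + Suc d}" for d i
  proof -
    have "lower i (g (Suc d)) = f (lower i (c (m + Suc d))) (lower i (g d))"
      unfolding g_Suc using that by (intro lower_f[OF c_ultra_FIN g_ultra_FIN]) auto
    also have "\<dots> = f (c (m + d)) (lower i (g d))" using lower_c[of i "m + Suc d"] that by simp
    also have "\<dots> = g d" using that by (intro key) auto
    finally show ?thesis .
  qed
  define y where "y = g (K - m)"
  have layer_high: "layer K j y = g (j - m)" if "m \<le> j" "j \<le> K" for j
  proof -
    have "lower 1 (g (Suc j - m)) = g (j - m)" if "m \<le> j" "j < K" for j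
      using lower_g[of "j - m" 1] that by (simp add: Suc_diff_le)
    then show ?thesis using layer_eqI[of m K "\<lambda>j. g (j - m)" j] that by (simp add: y_def)
  qed
  have layer_low: "layer K j y = c j" if "j \<le> m" for j
  proof -
    have "layer K j y = layer m j (layer K m y)" using layer_layer[OF that] m by simp
    also have "\<dots> = layer m j (layer K m e)" using layer_high[of m] m by (simp add: g_0 c_def)
    also have "\<dots> = c j" using layer_layer[OF that] m by (simp add: c_def)
    finally show ?thesis .
  qed
  have "lower i (layer K j y) = layer K (j - 1) y" if "j \<in> {1..K}" "i \<in> {1..j}" for i j
  proof (cases "j \<le> m")
    case True
    then show ?thesis using layer_low[of j] layer_low[of "j - 1"] lower_c that by simp
  next
    case False
    then obtain d where d: "j = m + Suc d" by (metis add_Suc_right less_imp_Suc_add not_le)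
    then show ?thesis using layer_high[of j] layer_high[of "j - 1"] lower_g[of d i] that by simp
  qed
  moreover have "y \<in> ultra_FIN K" using g_ultra_FIN[of "K - m"] m by (simp add: y_def)
  ultimately have "y \<in> coherent K" by (simp add: coherent_def)
  moreover have "layer K (Suc m) y = f (c (Suc m)) (c m)"
    using layer_high[of "Suc m"] m g_Suc[of 0] by (simp add: g_0 Suc_diff_le)
  ultimately show ?thesis using layer_low unfolding c_def by blast
qed

text \<open>The case \<open>i = j\<close> makes the entries up to \<open>m\<close> idempotent. The
  induction step keeps these entries and changes those above, first securing absorption on the right
  at level \<open>m + 1\<close>, then on the left.\<close>

lemma coherent_absorbing:
  "m \<le> K \<Longrightarrow> \<exists>x\<in>coherent K. \<forall>j\<le>m. \<forall>i\<le>j.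
     layer K i x \<boxplus> layer K j x = layer K j x \<and> layer K j x \<boxplus> layer K i x = layer K j x"
proof (induction m)
  case 0
  obtain x where "x \<in> coherent K" using coherent_nonempty by blast
  then show ?case using ultra_FIN_0_idem[OF layer_ultra_FIN[of 0 K x]] coherent_ultra_FIN by (intro bexI[of _ x]) auto
next
  case (Suc m)
  then obtain x where x: "x \<in> coherent K"
    and absorb: "\<And>i j. j \<le> m \<Longrightarrow> i \<le> j \<Longrightarrow> layer K i x \<boxplus> layer K j x = layer K j x"
      "\<And>i j. j \<le> m \<Longrightarrow> i \<le> j \<Longrightarrow> layer K j x \<boxplus> layer K i x = layer K j x"
    by auto
  define u where "u j = layer K j x" for j
  \<comment> \<open>Entry \<open>m\<close> determines all lower ones, and \<open>u m\<close> is
    idempotent, so \<open>X\<close> is a compact semigroup of families that keep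
    \<open>u 0, ..., u m\<close>.\<close>
  define X where "X = {y \<in> coherent K. layer K m y = u m}"
  have layer_X: "layer K j y = u j" if "y \<in> X" "j \<le> m" for j y
    using that layer_layer[of j m K y] layer_layer[of j m K x] Suc.prems by (simp add: X_def u_def)
  have "compact X"
  proof -
    have "closed {y. layer K m y = u m}"
      using continuous_layer by (intro closed_Collect_eq_bool_fun) auto
    from compact_Int_closed[OF compact_coherent[of K] this] show ?thesis
      by (simp add: X_def Collect_conj_eq)
  qed
  have X_uplus: "y \<boxplus> z \<in> X" if "y \<in> X" "z \<in> X" for y z
    using that Suc.prems absorb(1)[of m m]
    by (simp add: X_def coherent_uplus layer_uplus[OF coherent_ultra_FIN coherent_ultra_FIN] u_def)
  have X_sub: "X \<subseteq> ultra_FIN K" by (auto simp: X_def coherent_ultra_FIN)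
  have "x \<in> X" using x by (simp add: X_def u_def)
  \<comment> \<open>\<open>staircase\<close> needs idempotents at the levels above \<open>m\<close>
    as well, which the induction hypothesis does not give.\<close>
  then obtain e where e: "e \<in> X" "e \<boxplus> e = e"
    using ultra_FIN_idempotent[OF X_sub \<open>compact X\<close> _ X_uplus] by blast
  have "\<exists>y\<in>coherent K. (\<forall>j\<le>m. layer K j y = layer K j e) \<and>
           layer K (Suc m) y = layer K (Suc m) e \<boxplus> layer K m e"
    using e absorb(2) layer_X[OF e(1)] Suc.prems by (intro staircase) (auto simp: X_def u_def)
  then obtain y where y: "y \<in> coherent K" "\<And>j. j \<le> m \<Longrightarrow> layer K j y = layer K j e"
    "layer K (Suc m) y = layer K (Suc m) e \<boxplus> u m" using layer_X[OF e(1), of m] by auto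
  \<comment> \<open>Right absorption of \<open>u m\<close> at level \<open>m + 1\<close> depends
    only on the last summand, so it passes to sums, and it is closed; an idempotent of
    \<open>Y\<close> therefore regains idempotence without losing it.\<close>
  define Y where "Y = {y \<in> X. layer K (Suc m) y \<boxplus> u m = layer K (Suc m) y}"
  have "y \<in> X" using y layer_X[OF e(1), of m] by (simp add: X_def)
  moreover have "u m \<boxplus> u m = u m" using absorb(1) by (simp add: u_def)
  ultimately have "y \<in> Y" using y(3) by (simp add: Y_def uplus_assoc)
  have "compact Y"
  proof -
    have "continuous_on UNIV (\<lambda>y. layer K (Suc m) y \<boxplus> u m)"
      using continuous_on_compose[OF continuous_layer continuous_uplus] by (simp add: comp_def)
    then have "closed {y. layer K (Suc m) y \<boxplus> u m = layer K (Suc m) y}"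
      using continuous_layer by (intro closed_Collect_eq_bool_fun)
    from compact_Int_closed[OF \<open>compact X\<close> this] show ?thesis
      by (simp add: Y_def Collect_conj_eq)
  qed
  have Y_uplus: "z \<boxplus> z' \<in> Y" if "z \<in> Y" "z' \<in> Y" for z z'
    using that X_uplus X_sub Suc.prems by (simp add: Y_def layer_uplus uplus_assoc subset_iff)
  obtain e' where e': "e' \<in> Y" "e' \<boxplus> e' = e'"
    using ultra_FIN_idempotent[OF _ \<open>compact Y\<close> _ Y_uplus, of K] \<open>y \<in> Y\<close> X_sub by (auto simp: Y_def)
  then have e'X: "e' \<in> X" by (simp add: Y_def)
  have "\<exists>z\<in>coherent K. (\<forall>j\<le>m. layer K j z = layer K j e') \<and>
           layer K (Suc m) z = (\<lambda>a b. b \<boxplus> a) (layer K (Suc m) e') (layer K m e')"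
    using e'X e'(2) absorb(1) layer_X[OF e'X] Suc.prems by (intro staircase) (auto simp: X_def u_def)
  then obtain z where z: "z \<in> coherent K" "\<And>j. j \<le> m \<Longrightarrow> layer K j z = u j"
    "layer K (Suc m) z = u m \<boxplus> layer K (Suc m) e'" using layer_X[OF e'X] by auto
  define w where "w = layer K (Suc m) e'"
  have w: "w \<boxplus> u m = w" using e'(1) by (simp add: Y_def w_def)
  have ww: "w \<boxplus> w = w" using layer_uplus[of e' K e' "Suc m"] e'(2) e'X X_sub Suc.prems by (auto simp: w_def)
  have uu: "u i \<boxplus> u m = u m" "u m \<boxplus> u i = u m" if "i \<le> m" for i
    using absorb that by (simp_all add: u_def)
  \<comment> \<open>The new entry \<open>u m \<boxplus> w\<close> absorbs on the left through its
    first summand, and on the right through \<open>w\<close>, which already absorbs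
    \<open>u m\<close>. Its idempotence comes from that of \<open>w\<close>, as the inner
    \<open>w \<boxplus> u m\<close> collapses.\<close>
  have left: "u i \<boxplus> (u m \<boxplus> w) = u m \<boxplus> w" if "i \<le> m" for i
    by (simp only: uplus_assoc[symmetric] uu(1)[OF that])
  have right: "u m \<boxplus> w \<boxplus> u i = u m \<boxplus> w" if "i \<le> m" for i
  proof -
    have "w \<boxplus> u i = w \<boxplus> u m \<boxplus> u i" by (simp only: w)
    also have "\<dots> = w \<boxplus> u m" by (simp only: uplus_assoc uu(2)[OF that])
    finally have "w \<boxplus> u i = w" by (simp only: w)
    then show ?thesis by (simp only: uplus_assoc)
  qed
  have "u m \<boxplus> w \<boxplus> (u m \<boxplus> w) = u m \<boxplus> (w \<boxplus> u m) \<boxplus> w" by (simp only: uplus_assoc)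
  then have idem: "u m \<boxplus> w \<boxplus> (u m \<boxplus> w) = u m \<boxplus> w" by (simp only: w uplus_assoc ww)
  have "layer K i z \<boxplus> layer K j z = layer K j z \<and> layer K j z \<boxplus> layer K i z = layer K j z"
    if "j \<le> Suc m" "i \<le> j" for i j
  proof (cases "j = Suc m")
    case True
    have zj: "layer K j z = u m \<boxplus> w" using z(3) True by (simp add: w_def)
    show ?thesis
    proof (cases "i = Suc m")
      case True
      then show ?thesis using zj idem \<open>j = Suc m\<close> by simp
    next
      case False
      then have "i \<le> m" using that by simp
      then show ?thesis unfolding zj z(2)[OF \<open>i \<le> m\<close>] by (intro conjI left right)
    qed
  next
    case False
    then show ?thesis using that z(2)[of i] z(2)[of j] absorb[of j i] unfolding u_def by simp
  qed
  then show ?case using z(1) by blast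
qed

text \<open>Indices \<open>i\<close> outside the range 1 to \<open>j\<close> fix \<open>u j\<close>,
  so the finite set of the \<open>u j\<close> is closed under all \<open>T i\<close> and under
  addition, as the choice of blocks requires.\<close>

lemma coherent_ultrafilters:
  obtains u where "\<And>j. j \<le> K \<Longrightarrow> u j \<in> ultra_FIN j"
    and "\<And>i j. j \<le> K \<Longrightarrow> lower i (u j) \<in> u ` {..K}"
    and "\<And>i j. i \<le> K \<Longrightarrow> j \<le> K \<Longrightarrow> u i \<boxplus> u j = u (max i j)"
proof -
  obtain x where x: "x \<in> coherent K" and absorb: "\<forall>j\<le>K. \<forall>i\<le>j.
     layer K i x \<boxplus> layer K j x = layer K j x \<and> layer K j x \<boxplus> layer K i x = layer K j x"
    by (rule bexE[OF coherent_absorbing[OF order_refl]])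
  have ultra_FIN: "layer K j x \<in> ultra_FIN j" if "j \<le> K" for j
    using layer_ultra_FIN[OF that] coherent_ultra_FIN[OF x] .
  show thesis
  proof (rule that[of "\<lambda>j. layer K j x"])
    show "lower i (layer K j x) \<in> (\<lambda>j. layer K j x) ` {..K}" if "j \<le> K" for i j
    proof (cases "i \<in> {1..j}")
      case True
      then have "lower i (layer K j x) = layer K (j - 1) x" using x that by (simp add: coherent_def)
      then show ?thesis using that by (intro image_eqI[of _ _ "j - 1"]) auto
    next
      case False
      then have "i = 0 \<or> j < i" by auto
      then have "lower i (layer K j x) = layer K j x" by (rule lower_id[OF ultra_FIN[OF that]])
      then show ?thesis using that by (intro image_eqI[of _ _ j]) auto
    qed
    show "layer K i x \<boxplus> layer K j x = layer K (max i j) x" if "i \<le> K" "j \<le> K" for i j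
    proof (cases "i \<le> j")
      case True
      then show ?thesis using absorb that by (simp add: max_def)
    next
      case False
      then show ?thesis using absorb that by (simp add: max_def)
    qed
  qed (rule ultra_FIN)
qed

section \<open>The Galvin--Glazer argument\<close>

lemma ultra_finite_partition:
  assumes "ultra U" "U B" "finite C" "c ` B \<subseteq> C"
  obtains a where "U (B \<inter> c -` {a})"
proof (rule ccontr)
  assume "\<not> thesis"
  then have "U (- (B \<inter> c -` {a}))" for a
    using that ultra_Compl[OF assms(1)] by blast
  then have "U (\<Inter>a\<in>C. - (B \<inter> c -` {a}))"
    by (intro ultra_INT[OF assms(1,3)])
  then have "U (B \<inter> (\<Inter>a\<in>C. - (B \<inter> c -` {a})))"
    using assms(2) ultra_Int[OF assms(1)] by blast
  moreover have "B \<inter> (\<Inter>a\<in>C. - (B \<inter> c -` {a})) = {}" using assms(4) by auto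
  ultimately show False using ultra_nonempty[OF assms(1)] by fastforce
qed

text \<open>The family \<open>\<V>\<close> stands for \<open>u 0, ..., u k\<close> and
  \<open>F\<close> for the maps \<open>T_vec k t\<close>. Since \<open>\<V>\<close> and
  \<open>F\<close> are finite, each block has to satisfy only finitely many conditions that hold
  \<open>U\<close>-almost everywhere.\<close>

lemma galvin_glazer:
  assumes k: "k \<ge> 1" and U: "U \<in> ultra_FIN k"
    and \<V>: "finite \<V>" "U \<in> \<V>" "\<And>V. V \<in> \<V> \<Longrightarrow> ultra V"
      "\<And>V W. V \<in> \<V> \<Longrightarrow> W \<in> \<V> \<Longrightarrow> V \<boxplus> W \<in> \<V>"
      "\<And>V. V \<in> \<V> \<Longrightarrow> V \<boxplus> U = U" "\<And>V. V \<in> \<V> \<Longrightarrow> U \<boxplus> V = U"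
    and F: "finite F" "\<And>f. f \<in> F \<Longrightarrow> umap f U \<in> \<V>"
    and A: "U A"
  obtains b where "block_sequence k b"
    and "\<And>(q :: nat) s f. s ` {1..q} \<subseteq> {1..} \<Longrightarrow> strict_mono_on {1..q} s \<Longrightarrow> f ` {1..q} \<subseteq> F \<Longrightarrow>
           \<exists>j\<in>{1..q}. f j = id \<Longrightarrow> (\<lambda>x. \<Sum>j=1..q. f j (b (s j)) x) \<in> A"
proof -
  have ultra_U: "ultra U" using \<V>(2,3) by blast
  \<comment> \<open>Finite sums with an identity summand are kept in \<open>Q\<close>, arbitrary finite sums in \<open>R\<close>;
    membership in \<open>Q\<close> and \<open>R\<close> is preserved by almost all next elements.\<close>
  define Q where "Q = {p \<in> A. \<forall>V\<in>\<V>. V {y. p + y \<in> A}}"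
  define R where "R = {p. U {y. p + y \<in> Q}}"
  have Q_eq: "{y. p + y \<in> Q} = {y. p + y \<in> A} \<inter> (\<Inter>W\<in>\<V>. {y. W {z. p + y + z \<in> A}})" for p
    by (auto simp: Q_def)
  have "U (\<Inter>V\<in>\<V>. {p. V {y. p + y \<in> A}})"
  proof (rule ultra_INT[OF ultra_U \<V>(1)])
    fix V assume "V \<in> \<V>"
    then have "(U \<boxplus> V) A" using \<V>(6) A by simp
    then show "U {p. V {y. p + y \<in> A}}" by (simp add: uplus_def)
  qed
  moreover have "Q = A \<inter> (\<Inter>V\<in>\<V>. {p. V {y. p + y \<in> A}})" by (auto simp: Q_def)
  ultimately have UQ: "U Q" using A ultra_Int[OF ultra_U] by simp
  \<comment> \<open>\<open>V \<boxplus> W\<close> is again in \<open>\<V>\<close>, so what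
    \<open>p\<close> satisfies for it passes to almost every \<open>p + y\<close>.\<close>
  have Q_step: "V {y. p + y \<in> Q}" if "p \<in> Q" "V \<in> \<V>" for p V
  proof -
    have "V {y. W {z. p + y + z \<in> A}}" if "W \<in> \<V>" for W
    proof -
      have "(V \<boxplus> W) {y. p + y \<in> A}" using \<open>p \<in> Q\<close> \<V>(4)[OF \<open>V \<in> \<V>\<close> that] unfolding Q_def by blast
      then show ?thesis by (simp add: uplus_def add.assoc)
    qed
    then have "V (\<Inter>W\<in>\<V>. {y. W {z. p + y + z \<in> A}})"
      by (rule ultra_INT[OF \<V>(3)[OF that(2)] \<V>(1)])
    moreover have "V {y. p + y \<in> A}" using that unfolding Q_def by blast
    ultimately show ?thesis unfolding Q_eq using ultra_Int[OF \<V>(3)[OF that(2)]] by blast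
  qed
  \<comment> \<open>Here the absorption \<open>V \<boxplus> U = U\<close> replaces closure under
    addition.\<close>
  have R_step: "V {y. p + y \<in> R}" if "p \<in> R" "V \<in> \<V>" for p V
  proof -
    have "(V \<boxplus> U) {y. p + y \<in> Q}" using that \<V>(5) by (simp add: R_def)
    then show ?thesis by (simp add: uplus_def R_def add.assoc)
  qed
  have zero_R: "0 \<in> R" using UQ by (simp add: R_def)
  \<comment> \<open>A state consists of the latest block, the sums with an identity summand, and the
    sums of arbitrary images under \<open>F\<close>, including the empty sum 0.\<close>
  define good where "good = (\<lambda>(b, G, H). 0 \<in> H \<and> b \<in> FIN k \<and> finite G \<and> finite H \<and> G \<subseteq> Q \<and> H \<subseteq> R)"
  define nxt where "nxt = (\<lambda>(b, G, H) (b', G', H').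
    b' \<in> vanishing (Max (supp b)) \<and>
    G' = G \<union> (\<lambda>(p, f). p + f b') ` (G \<times> F) \<union> (\<lambda>p. p + b') ` H \<and>
    H' = H \<union> (\<lambda>(p, f). p + f b') ` (H \<times> F))"
  have "\<exists>\<sigma>. \<forall>n. good (\<sigma> n) \<and> nxt (\<sigma> n) (\<sigma> (Suc n))"
  proof (rule dependent_nat_choice)
    have "U (FIN k)" using U by (simp add: ultra_FIN_def)
    from ultra_nonempty[OF ultra_U this] obtain b where "b \<in> FIN k" by blast
    \<comment> \<open>The initial block has index 0 and enters no sum, as the sequence is read from
      index 1.\<close>
    then show "\<exists>\<sigma>. good \<sigma>"
      using zero_R by (intro exI[of _ "(b, {}, {0})"]) (simp add: good_def)
  next
    fix \<sigma> and n :: nat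
    assume "good \<sigma>"
    then obtain b G H where \<sigma>: "\<sigma> = (b, G, H)" and zero_H: "0 \<in> H" and G: "finite G" "G \<subseteq> Q" and H: "finite H" "H \<subseteq> R"
      by (auto simp: good_def)
    have "U (FIN k)" "U (vanishing (Max (supp b)))" using U by (auto simp: ultra_FIN_def)
    moreover have "U (\<Inter>(p, f)\<in>G \<times> F. {y. p + f y \<in> Q})"
    proof (rule ultra_INT[OF ultra_U])
      fix pf assume "pf \<in> G \<times> F"
      then show "U (case pf of (p, f) \<Rightarrow> {y. p + f y \<in> Q})"
        using Q_step[OF _ F(2), of "fst pf" "snd pf"] G(2) by (auto simp: umap_def vimage_def)
    qed (use G F in simp)
    moreover have "U (\<Inter>p\<in>H. {y. p + y \<in> Q})"
      using H by (intro ultra_INT[OF ultra_U]) (auto simp: R_def)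
    moreover have "U (\<Inter>(p, f)\<in>H \<times> F. {y. p + f y \<in> R})"
    proof (rule ultra_INT[OF ultra_U])
      fix pf assume "pf \<in> H \<times> F"
      then show "U (case pf of (p, f) \<Rightarrow> {y. p + f y \<in> R})"
        using R_step[OF _ F(2), of "fst pf" "snd pf"] H(2) by (auto simp: umap_def vimage_def)
    qed (use H F in simp)
    ultimately have "U (FIN k \<inter> vanishing (Max (supp b)) \<inter> (\<Inter>(p, f)\<in>G \<times> F. {y. p + f y \<in> Q}) \<inter>
        (\<Inter>p\<in>H. {y. p + y \<in> Q}) \<inter> (\<Inter>(p, f)\<in>H \<times> F. {y. p + f y \<in> R}))"
      by (simp only: ultra_Int[OF ultra_U] simp_thms)
    from ultra_nonempty[OF ultra_U this] obtain b' where
      "b' \<in> FIN k \<inter> vanishing (Max (supp b)) \<inter> (\<Inter>(p, f)\<in>G \<times> F. {y. p + f y \<in> Q}) \<inter>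
        (\<Inter>p\<in>H. {y. p + y \<in> Q}) \<inter> (\<Inter>(p, f)\<in>H \<times> F. {y. p + f y \<in> R})" ..
    then have b': "b' \<in> FIN k" "b' \<in> vanishing (Max (supp b))"
      "\<And>p f. p \<in> G \<Longrightarrow> f \<in> F \<Longrightarrow> p + f b' \<in> Q" "\<And>p. p \<in> H \<Longrightarrow> p + b' \<in> Q"
      "\<And>p f. p \<in> H \<Longrightarrow> f \<in> F \<Longrightarrow> p + f b' \<in> R"
      by auto
    define G' where "G' = G \<union> (\<lambda>(p, f). p + f b') ` (G \<times> F) \<union> (\<lambda>p. p + b') ` H"
    define H' where "H' = H \<union> (\<lambda>(p, f). p + f b') ` (H \<times> F)"
    have "good (b', G', H')" using zero_H b' G H F by (auto simp: good_def G'_def H'_def)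
    moreover have "nxt \<sigma> (b', G', H')" using b' by (simp add: nxt_def \<sigma> G'_def H'_def)
    ultimately show "\<exists>\<sigma>'. good \<sigma>' \<and> nxt \<sigma> \<sigma>'" by blast
  qed
  then obtain \<sigma> where \<sigma>: "\<And>n. good (\<sigma> n)" "\<And>n. nxt (\<sigma> n) (\<sigma> (Suc n))" by blast
  define b where "b n = fst (\<sigma> n)" for n
  define G where "G n = fst (snd (\<sigma> n))" for n
  define H where "H n = snd (snd (\<sigma> n))" for n
  have b: "b n \<in> FIN k" and GQ: "G n \<subseteq> Q" and zero_H: "0 \<in> H n" for n
    using \<sigma>(1)[of n] by (simp_all add: good_def b_def G_def H_def split: prod.splits)
  have b_Suc: "b (Suc n) \<in> vanishing (Max (supp (b n)))"
    and G_Suc: "G (Suc n) = G n \<union> (\<lambda>(p, f). p + f (b (Suc n))) ` (G n \<times> F) \<union> (\<lambda>p. p + b (Suc n)) ` H n"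
    and H_Suc: "H (Suc n) = H n \<union> (\<lambda>(p, f). p + f (b (Suc n))) ` (H n \<times> F)" for n
    using \<sigma>(2)[of n] by (auto simp: nxt_def b_def G_def H_def split: prod.splits)
  have G_mono: "G m \<subseteq> G n" and H_mono: "H m \<subseteq> H n" if "m \<le> n" for m n
    using that by (induction n rule: dec_induct) (auto simp: G_Suc H_Suc)
  show thesis
  proof (rule that)
    have "Max (supp (b n)) < Min (supp (b (Suc n)))" for n
    proof -
      obtain x where "b (Suc n) x = k" using b[of "Suc n"] by (auto simp: FIN_def)
      then have "x \<in> supp (b (Suc n))" using k by (simp add: supp_def)
      then have "supp (b (Suc n)) \<noteq> {}" by blast
      moreover have "finite (supp (b (Suc n)))" using b[of "Suc n"] by (simp add: FIN_def)
      ultimately have "Min (supp (b (Suc n))) \<in> supp (b (Suc n))" by (rule Min_in[rotated])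
      then have "b (Suc n) (Min (supp (b (Suc n)))) \<noteq> 0"
        unfolding supp_def[of "b (Suc n)"] by (rule CollectD)
      moreover have "\<forall>x\<le>Max (supp (b n)). b (Suc n) x = 0"
        using b_Suc[of n] unfolding vanishing_def by (rule CollectD)
      ultimately show ?thesis by (meson not_le)
    qed
    then show "block_sequence k b" using b by (simp add: block_sequence_def)
  next
    fix q :: nat and s :: "nat \<Rightarrow> nat" and f :: "nat \<Rightarrow> (nat \<Rightarrow> nat) \<Rightarrow> nat \<Rightarrow> nat"
    assume s: "s ` {1..q} \<subseteq> {1..}" "strict_mono_on {1..q} s" "f ` {1..q} \<subseteq> F" and id: "\<exists>j\<in>{1..q}. f j = id"
    \<comment> \<open>The bound \<open>n\<close> on the indices is kept arbitrary: the last block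
      used has index \<open>Suc m\<close>, so the preceding partial sum is already in
      \<open>H m\<close>, and in \<open>G m\<close> if it has an identity summand.\<close>
    have "s ` {1..q} \<subseteq> {1..} \<Longrightarrow> strict_mono_on {1..q} s \<Longrightarrow> f ` {1..q} \<subseteq> F \<Longrightarrow>
       \<forall>j\<in>{1..q}. s j \<le> n \<Longrightarrow> (\<lambda>x. \<Sum>j=1..q. f j (b (s j)) x) \<in> H n \<and>
       ((\<exists>j\<in>{1..q}. f j = id) \<longrightarrow> (\<lambda>x. \<Sum>j=1..q. f j (b (s j)) x) \<in> G n)" for n
    proof (induction q arbitrary: n)
      case 0
      show ?case using zero_H[of n] by (simp add: zero_fun_def)
    next
      case (Suc q)
      define p where "p = (\<lambda>x. \<Sum>j=1..q. f j (b (s j)) x)"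
      have "s (Suc q) \<ge> 1" using subsetD[OF Suc.prems(1) imageI[of "Suc q"]] by simp
      then obtain m where m: "s (Suc q) = Suc m" by (cases "s (Suc q)") auto
      have le_m: "\<forall>j\<in>{1..q}. s j \<le> m"
        using strict_mono_onD[OF Suc.prems(2), of _ "Suc q"] m by fastforce
      have sub: "s ` {1..q} \<subseteq> {1..}" "f ` {1..q} \<subseteq> F"
        using Suc.prems(1,3) by (simp_all add: image_subset_iff)
      have "p \<in> H m \<and> ((\<exists>j\<in>{1..q}. f j = id) \<longrightarrow> p \<in> G m)"
        unfolding p_def
        by (rule Suc.IH[OF sub(1) monotone_on_subset[OF Suc.prems(2)] sub(2) le_m]) auto
      then have p: "p \<in> H m" "(\<exists>j\<in>{1..q}. f j = id) \<Longrightarrow> p \<in> G m" by blast+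
      have eq: "(\<lambda>x. \<Sum>j=1..Suc q. f j (b (s j)) x) = p + f (Suc q) (b (Suc m))"
        by (simp add: p_def fun_eq_iff m)
      have f: "f (Suc q) \<in> F" using subsetD[OF Suc.prems(3) imageI[of "Suc q"]] by simp
      have mn: "Suc m \<le> n" using Suc.prems(4) m by (metis atLeastAtMost_iff le_add1 order_refl plus_1_eq_Suc)
      have "p + f (Suc q) (b (Suc m)) \<in> H (Suc m)" using p(1) f by (force simp: H_Suc)
      \<comment> \<open>An identity summand in last place moves the sum from \<open>H\<close> to
        \<open>G\<close>; one in an earlier place has put the partial sum into \<open>G\<close>
        before.\<close>
      moreover have "p + f (Suc q) (b (Suc m)) \<in> G (Suc m)" if "\<exists>j\<in>{1..Suc q}. f j = id"
      proof (cases "f (Suc q) = id")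
        case True
        then show ?thesis using p(1) by (auto simp: G_Suc)
      next
        case False
        from that obtain j where j: "j \<in> {1..Suc q}" "f j = id" by (rule bexE)
        then have "j \<noteq> Suc q" using False by blast
        then have "j \<in> {1..q}" using j(1) by simp
        then have "p \<in> G m" using j(2) by (intro p(2) bexI)
        then show ?thesis using f by (force simp: G_Suc)
      qed
      ultimately show ?case unfolding eq using G_mono[OF mn] H_mono[OF mn] by blast
    qed
    from this[OF s, of "Max (s ` {1..q})"] id have "(\<lambda>x. \<Sum>j=1..q. f j (b (s j)) x) \<in> G (Max (s ` {1..q}))"
      by auto
    then show "(\<lambda>x. \<Sum>j=1..q. f j (b (s j)) x) \<in> A" using GQ by (auto simp: Q_def)
  qed
qed

section \<open>Application to a colouring and the maps \<open>T_vec k t\<close>\<close>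

theorem theorem2p5:
  fixes k r :: nat and l :: "nat \<Rightarrow> nat" and c :: "(nat \<Rightarrow> nat) \<Rightarrow> nat"
  assumes "k \<ge> 1" and "r \<ge> 1"
    and "\<And>j. j \<in> {1..k} \<Longrightarrow> l j \<in> {0..j - 1}"
    and "c \<in> FIN k \<rightarrow> {1..r}"
  shows "\<exists>b. block_sequence k b \<and>
           c constant_on block_span k (\<Pi>\<^sub>E j\<in>{1..k}. {0, l j, l j + 1}) b"
proof -
  define I where "I = (\<Pi>\<^sub>E j\<in>{1..k}. {0, l j, l j + 1})"
  have "finite I" unfolding I_def by (intro finite_PiE) auto
  obtain u where u: "\<And>j. j \<le> k \<Longrightarrow> u j \<in> ultra_FIN j"
    and lower_u: "\<And>i j. j \<le> k \<Longrightarrow> lower i (u j) \<in> u ` {..k}"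
    and u_uplus: "\<And>i j. i \<le> k \<Longrightarrow> j \<le> k \<Longrightarrow> u i \<boxplus> u j = u (max i j)"
    by (rule coherent_ultrafilters[of k]) (rule that, assumption+)
  \<comment> \<open>Each \<open>T (t j)\<close> maps the finite set of the \<open>u i\<close> into
    itself, hence so does their composition.\<close>
  have T_vec_u: "umap (T_vec n t) V \<in> u ` {..k}" if "V \<in> u ` {..k}" for n t V
    using that
  proof (induction n arbitrary: V)
    case (Suc n)
    then have "lower (t (Suc n)) V \<in> u ` {..k}" using lower_u by auto
    then show ?case using Suc.IH unfolding T_vec.simps umap_umap[symmetric] by blast
  qed (simp add: umap_def[abs_def])
  have U: "ultra (u k)" "u k (FIN k)" using u[of k] by (auto simp: ultra_FIN_def)
  obtain a where a: "u k (FIN k \<inter> c -` {a})"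
    using ultra_finite_partition[OF U, of "{1..r}" c] assms(4) by blast
  have V_ultra: "ultra V" if "V \<in> u ` {..k}" for V using that u by (auto simp: ultra_FIN_def)
  have V_uplus: "V \<boxplus> W \<in> u ` {..k}" if "V \<in> u ` {..k}" "W \<in> u ` {..k}" for V W
  proof -
    from that(1) obtain i where i: "V = u i" "i \<in> {..k}" by (rule imageE)
    from that(2) obtain j where j: "W = u j" "j \<in> {..k}" by (rule imageE)
    show ?thesis using i j by (intro image_eqI[of _ _ "max i j"]) (simp_all add: u_uplus)
  qed
  have V_left: "V \<boxplus> u k = u k" and V_right: "u k \<boxplus> V = u k" if "V \<in> u ` {..k}" for V
    using that by (auto simp: u_uplus max_absorb1 max_absorb2)
  have fin: "finite (u ` {..k})" "u k \<in> u ` {..k}" and F_fin: "finite (T_vec k ` I)"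
    using \<open>finite I\<close> by auto
  have F_umap: "umap f (u k) \<in> u ` {..k}" if "f \<in> T_vec k ` I" for f
    using that T_vec_u by auto
  obtain b where b: "block_sequence k b"
    and mono: "\<And>(q :: nat) s f. s ` {1..q} \<subseteq> {1..} \<Longrightarrow> strict_mono_on {1..q} s \<Longrightarrow> f ` {1..q} \<subseteq> T_vec k ` I \<Longrightarrow>
           \<exists>j\<in>{1..q}. f j = id \<Longrightarrow> (\<lambda>x. \<Sum>j=1..q. f j (b (s j)) x) \<in> FIN k \<inter> c -` {a}"
    by (rule galvin_glazer[OF assms(1) u[OF order_refl] fin V_ultra V_uplus V_left V_right F_fin F_umap a])
      (assumption | rule that)+
  have "c p = a" if p: "p \<in> block_span k I b" for p
  proof -
    obtain q :: nat and s t j0 where pq: "p = (\<lambda>x. \<Sum>j=1..q. T_vec k (t j) (b (s j)) x)"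
      and s: "s ` {1..q} \<subseteq> {1..}" "strict_mono_on {1..q} s"
      and t: "t ` {1..q} \<subseteq> I" and j0: "j0 \<in> {1..q}" "t j0 = zero_vec k"
      using p unfolding block_span_def by blast
    have "(\<lambda>j. T_vec k (t j)) ` {1..q} \<subseteq> T_vec k ` I" using t by blast
    moreover have "\<exists>j\<in>{1..q}. T_vec k (t j) = id" using j0 T_vec_zero_vec by (intro bexI[of _ j0]) simp_all
    ultimately have "p \<in> FIN k \<inter> c -` {a}" unfolding pq by (rule mono[OF s])
    then show ?thesis by simp
  qed
  then have "c constant_on block_span k I b" unfolding constant_on_def by blast
  then show ?thesis using b unfolding I_def by blast
qed

end
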